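(* Let $G$ be a simple graph with vertex set $V(G)=\{v_1,\dots,v_n\}$ and $m$ edges, let $S\subseteq V(G)$ with $|S|=\sigma$, and let $G_S$ be the graph obtained from $G$ by attaching one self-loop at each vertex of $S$. Let $\lambda_1,\dots,\lambda_n$ be the adjacency eigenvalues of $G_S$, indexed so that $\left|\lambda_1-\frac{\sigma}{n}\right|\ge\dots\ge\left|\lambda_n-\frac{\sigma}{n}\right|$. Then $$E(G_S)\ge\sqrt{n\left(2m+\sigma-\frac{\sigma^2}{n}\right)-\frac{n^2}{3}\left(\left|\lambda_1-\frac{\sigma}{n}\right|-\left|\lambda_n-\frac{\sigma}{n}\right|\right)^2}.$$
   Context: The adjacency matrix $A(G_S)=[a_{ij}]$ is the $n\times n$ symmetric $0/1$ matrix with, for $i\ne j$, $a_{ij}=1$ iff $v_i,v_j$ are adjacent, and $a_{ii}=1$ iff $v_i\in S$; its eigenvalues are the adjacency eigenvalues of $G_S$. The energy is $E(G_S)=\sum_{i=1}^n\left|\lambda_i-\frac{\sigma}{n}\right|$. Here $m$ counts only edges of $G$ (not loops). *)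

theory Defs
  imports Complex_Main "Jordan_Normal_Form.Char_Poly"
begin

definition simple_graph :: "'a set \<Rightarrow> 'a set set \<Rightarrow> bool" where
  "simple_graph V E \<longleftrightarrow> finite V \<and> E \<subseteq> {e. e \<subseteq> V \<and> card e = 2}"

(* The graph G_S is represented by the repetition-free list vs of its vertices (fixing their order),
   the set E of the edges of G (which contains no loops), and the set S of the vertices
   that carry a self-loop. A loop contributes 1, not 2, to the diagonal. *)
definition loop_adj_matrix :: "'a list \<Rightarrow> 'a set set \<Rightarrow> 'a set \<Rightarrow> real mat" where
  "loop_adj_matrix vs E S = mat (length vs) (length vs) (\<lambda>(i, j).
     if i = j then (if vs ! i \<in> S then 1 else 0)
     else (if {vs ! i, vs ! j} \<in> E then 1 else 0))"

(* Eigenvalues with multiplicity. The matrix is real symmetric, so all its eigenvalues are real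
   and this multiset has as many elements as there are vertices. *)
definition loop_adj_eigenvalues :: "'a list \<Rightarrow> 'a set set \<Rightarrow> 'a set \<Rightarrow> real multiset" where
  "loop_adj_eigenvalues vs E S = proots (char_poly (loop_adj_matrix vs E S))"

definition loop_energy :: "'a list \<Rightarrow> 'a set set \<Rightarrow> 'a set \<Rightarrow> real" where
  "loop_energy vs E S =
     (\<Sum>x\<in>#loop_adj_eigenvalues vs E S. \<bar>x - real (card S) / real (length vs)\<bar>)"

end

theory Submission
  imports Defs "Jordan_Normal_Form.Schur_Decomposition"
begin

text \<open>
  Put \<open>c = \<sigma> / n\<close> and \<open>a\<^sub>i = \<bar>\<lambda>\<^sub>i - c\<bar>\<close>, so that the energy is \<open>\<Sum> a\<^sub>i\<close>. The traces of the adjacency matrix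
  and of its square give \<open>\<Sum> \<lambda>\<^sub>i = \<sigma>\<close> and \<open>\<Sum> \<lambda>\<^sub>i\<^sup>2 = 2 m + \<sigma>\<close>, hence
  \<open>\<Sum> a\<^sub>i\<^sup>2 = 2 m + \<sigma> - \<sigma>\<^sup>2 / n\<close>. Since all \<open>a\<^sub>i\<close> lie in \<open>[a\<^sub>n, a\<^sub>1]\<close>, Popoviciu's inequality bounds
  \<open>n \<Sum> a\<^sub>i\<^sup>2 - (\<Sum> a\<^sub>i)\<^sup>2\<close> by \<open>n\<^sup>2 (a\<^sub>1 - a\<^sub>n)\<^sup>2 / 4\<close>, which is even better than the claimed constant \<open>1 / 3\<close>.
\<close>

text \<open>The induction splits off a root with its full multiplicity \<open>k\<close>; this lowers
  \<open>size (proots _)\<close> and the degree by the same \<open>k\<close>, so the hypothesis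
  passes to the cofactor. It supplies the linear factors that Schur triangularization asks
  for.\<close>

lemma poly_eq_prod_proots:
  fixes p :: "'a :: idom poly"
  assumes "size (proots p) = degree p"
  shows "p = Polynomial.smult (lead_coeff p) (\<Prod>a\<in>#proots p. [:- a, 1:])"
  using assms
proof (induction p rule: poly_root_order_induct)
  case 0
  then show ?case by simp
next
  case (no_roots p)
  \<comment> \<open>Without roots, the hypothesis forces degree 0.\<close>
  then have "proots p = {#}"
    by (simp add: multiset_eqI order_root)
  with no_roots.prems show ?case
    by (auto elim: degree_eq_zeroE)
next
  case (root p x k)
  have p0: "p \<noteq> 0"
    using root.hyps by auto
  have roots: "proots ([:- x, 1:] ^ k * p) = repeat_mset k {#x#} + proots p"
    using p0 by (simp add: proots_mult proots_power)
  have "size (proots p) = degree p"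
    using root.prems p0 unfolding roots by (simp add: degree_mult_eq degree_power_eq)
  from root.IH[OF this]
  have "[:- x, 1:] ^ k * p =
      Polynomial.smult (lead_coeff p) ([:- x, 1:] ^ k * (\<Prod>a\<in>#proots p. [:- a, 1:]))"
    by (metis mult_smult_right)
  moreover have "lead_coeff ([:- x, 1:] ^ k * p) = lead_coeff p"
    by (simp add: lead_coeff_mult lead_coeff_power)
  moreover have "(\<Prod>a\<in>#repeat_mset k {#x#} + proots p. [:- a, 1:]) =
      [:- x, 1:] ^ k * (\<Prod>a\<in>#proots p. [:- a, 1:])"
    by (simp only: repeat_mset_replicate_mset image_mset_union image_replicate_mset prod_mset.union
      prod_mset_replicate_mset)
  ultimately show ?case
    unfolding roots by (simp only:)
qed

lemma sum_list_diag_mat: "sum_list (diag_mat A) = (\<Sum>i<dim_row A. A $$ (i, i))"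
  by (simp add: diag_mat_def interv_sum_list_conv_sum_set_nat atLeast0LessThan)

lemma sum_list_diag_mat_mult:
  assumes "A \<in> carrier_mat n k" "B \<in> carrier_mat k n"
  shows "sum_list (diag_mat (A * B)) = (\<Sum>i<n. \<Sum>j<k. A $$ (i, j) * B $$ (j, i))"
  using assms by (simp add: sum_list_diag_mat scalar_prod_def atLeast0LessThan)

lemma sum_list_diag_mat_mult_comm:
  fixes A B :: "'a :: comm_semiring_0 mat"
  assumes "A \<in> carrier_mat n k" "B \<in> carrier_mat k n"
  shows "sum_list (diag_mat (A * B)) = sum_list (diag_mat (B * A))"
  unfolding sum_list_diag_mat_mult[OF assms] sum_list_diag_mat_mult[OF assms(2,1)]
  by (subst sum.swap) (simp add: mult.commute)

text \<open>Writing \<open>A = P * (B * Q)\<close>, the trace lets \<open>P\<close> move to the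
  right end, where \<open>Q * P\<close> cancels.\<close>

lemma sum_list_diag_mat_similar:
  fixes A B :: "'a :: comm_semiring_1 mat"
  assumes "similar_mat_wit A B P Q"
  shows "sum_list (diag_mat A) = sum_list (diag_mat B)"
proof -
  define n where "n = dim_row A"
  note sim = similar_mat_witD[OF n_def assms]
  have BQ: "B * Q \<in> carrier_mat n n"
    using sim(5,7) by simp
  have "A = P * (B * Q)"
    unfolding sim(3) by (rule assoc_mult_mat[OF sim(6,5,7)])
  then have "sum_list (diag_mat A) = sum_list (diag_mat (P * (B * Q)))"
    by (rule arg_cong)
  also have "\<dots> = sum_list (diag_mat (B * Q * P))"
    by (rule sum_list_diag_mat_mult_comm[OF sim(6) BQ])
  also have "B * Q * P = B"
    using assoc_mult_mat[OF sim(5,7,6)] sim(2,5) by simp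
  finally show ?thesis .
qed

text \<open>For distinct indices, one of the entries \<open>(i, j)\<close> and \<open>(j, i)\<close>
  lies below the diagonal and is 0.\<close>

lemma upper_triangular_sum_list_diag_mat_square:
  fixes B :: "'a :: comm_semiring_1 mat"
  assumes B: "B \<in> carrier_mat n n" and ut: "upper_triangular B"
  shows "sum_list (diag_mat (B * B)) = (\<Sum>x\<leftarrow>diag_mat B. x\<^sup>2)"
proof -
  have "(\<Sum>j<n. B $$ (i, j) * B $$ (j, i)) = (B $$ (i, i))\<^sup>2" if i: "i < n" for i
  proof -
    have "B $$ (i, j) * B $$ (j, i) = 0" if "j < n" "j \<noteq> i" for j
      using B ut i that by (cases j i rule: linorder_cases) (auto dest: upper_triangularD)
    then have "(\<Sum>j<n. B $$ (i, j) * B $$ (j, i)) = (\<Sum>j\<in>{i}. B $$ (i, j) * B $$ (j, i))"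
      using i by (intro sum.mono_neutral_right) auto
    then show ?thesis by (simp add: power2_eq_square)
  qed
  then show ?thesis
    using B unfolding sum_list_diag_mat_mult[OF B B]
    by (simp add: diag_mat_def comp_def interv_sum_list_conv_sum_set_nat atLeast0LessThan)
qed

text \<open>The size hypothesis says that the characteristic polynomial splits over the field, so
  \<open>A\<close> is similar to a triangular \<open>B\<close>, from whose diagonal both power sums
  can be read.\<close>

lemma sum_mset_proots_char_poly:
  fixes A :: "'a :: conjugatable_ordered_field mat"
  assumes A: "A \<in> carrier_mat n n" and size: "size (proots (char_poly A)) = n"
  shows "(\<Sum>x\<in>#proots (char_poly A). x) = sum_list (diag_mat A)"
    and "(\<Sum>x\<in>#proots (char_poly A). x\<^sup>2) = sum_list (diag_mat (A * A))"
proof -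
  obtain es where es: "mset es = proots (char_poly A)"
    using ex_mset by blast
  have "degree (char_poly A) = n" "lead_coeff (char_poly A) = 1"
    using degree_monic_char_poly[OF A] by auto
  with poly_eq_prod_proots[of "char_poly A"] size
  have "char_poly A = (\<Prod>a\<in>#proots (char_poly A). [:- a, 1:])"
    by simp
  then have linear: "char_poly A = (\<Prod>a\<leftarrow>es. [:- a, 1:])"
    by (simp flip: es prod_mset_prod_list)
  obtain B where B: "B \<in> carrier_mat n n" and ut: "upper_triangular B" and "similar_mat A B"
    using schur_decomposition_exists[OF A linear] by blast
  then obtain P Q where sim: "similar_mat_wit A B P Q"
    by (auto simp: similar_mat_def)
  \<comment> \<open>Similarity preserves the characteristic polynomial, so the diagonal of
    \<open>B\<close> lists the eigenvalues of \<open>A\<close> with multiplicity.\<close>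
  have "char_poly A = (\<Prod>a\<leftarrow>diag_mat B. [:- a, 1:])"
    using char_poly_similar[OF \<open>similar_mat A B\<close>] char_poly_upper_triangular[OF B ut] by simp
  then have diag: "proots (char_poly A) = mset (diag_mat B)"
    using proots_prod_list[of "map (\<lambda>a. [:- a, 1:]) (diag_mat B)"]
    by (simp add: comp_def image_iff)
  \<comment> \<open>The same \<open>P\<close> and \<open>Q\<close> conjugate the squares.\<close>
  have sim2: "similar_mat_wit (A * A) (B * B) P Q"
    using similar_mat_wit_pow[OF sim, of 2] A B by (simp add: numeral_2_eq_2)
  show "(\<Sum>x\<in>#proots (char_poly A). x) = sum_list (diag_mat A)"
    unfolding diag sum_list_diag_mat_similar[OF sim] by (simp add: sum_mset_sum_list)
  show "(\<Sum>x\<in>#proots (char_poly A). x\<^sup>2) = sum_list (diag_mat (A * A))"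
    unfolding diag sum_list_diag_mat_similar[OF sim2]
      upper_triangular_sum_list_diag_mat_square[OF B ut]
    by (simp flip: mset_map add: sum_mset_sum_list)
qed

text \<open>The map from \<open>(u, v)\<close> to \<open>{u, v}\<close> has disjoint fibres of two
  elements over the edges.\<close>

lemma card_ordered_edges:
  assumes "simple_graph V E"
  shows "card {(u, v). {u, v} \<in> E \<and> u \<noteq> v} = 2 * card E"
proof -
  have E: "finite E" "\<And>e. e \<in> E \<Longrightarrow> card e = 2"
    using assms by (auto simp: simple_graph_def intro: finite_subset[of E "Pow V"])
  have two: "card {(u, v). {u, v} = e \<and> u \<noteq> v} = 2 \<and> finite {(u, v). {u, v} = e \<and> u \<noteq> v}"
    if e_in: "e \<in> E" for e
  proof -
    obtain x y where e: "e = {x, y}" "x \<noteq> y"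
      using E(2)[OF e_in] by (auto simp: card_2_iff)
    then have "{(u, v). {u, v} = e \<and> u \<noteq> v} = {(x, y), (y, x)}"
      by (auto simp: doubleton_eq_iff)
    then show ?thesis using e by simp
  qed
  have "{(u, v). {u, v} \<in> E \<and> u \<noteq> v} = (\<Union>e\<in>E. {(u, v). {u, v} = e \<and> u \<noteq> v})"
    by auto
  then have "card {(u, v). {u, v} \<in> E \<and> u \<noteq> v} = (\<Sum>e\<in>E. card {(u, v). {u, v} = e \<and> u \<noteq> v})"
    using E(1) two by (simp only:, subst card_UN_disjoint) auto
  then show ?thesis
    using two by simp
qed

lemma trace_loop_adj_matrix:
  assumes "distinct vs" "S \<subseteq> set vs"
  shows "sum_list (diag_mat (loop_adj_matrix vs E S)) = real (card S)"
proof -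
  have "sum_list (diag_mat (loop_adj_matrix vs E S)) =
      (\<Sum>i<length vs. if vs ! i \<in> S then 1 else 0)"
    by (simp add: sum_list_diag_mat loop_adj_matrix_def)
  also have "\<dots> = (\<Sum>v\<in>set vs. if v \<in> S then 1 else 0)"
    using bij_betw_nth[OF assms(1) refl refl] by (rule sum.reindex_bij_betw)
  also have "\<dots> = real (card S)"
    using assms(2) by (simp add: sum.If_cases Int_absorb1)
  finally show ?thesis .
qed

text \<open>The trace of the square of a symmetric 0/1 matrix counts its nonzero entries: two for
  each edge and one for each loop.\<close>

lemma trace_loop_adj_matrix_square:
  assumes "distinct vs" "S \<subseteq> set vs" and G: "simple_graph (set vs) E"
  shows "sum_list (diag_mat (loop_adj_matrix vs E S * loop_adj_matrix vs E S)) =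
    2 * real (card E) + real (card S)"
proof -
  define V where "V = set vs"
  define a where "a u v = (if u = v then if u \<in> S then 1 else 0
    else if {u, v} \<in> E then 1 else (0::real))" for u v
  have V: "finite V" "S \<subseteq> V"
    using assms by (auto simp: V_def)
  have EV: "u \<in> V \<and> v \<in> V" if "{u, v} \<in> E" for u v
    using G that by (auto simp: simple_graph_def V_def)
  note bij = bij_betw_nth[OF assms(1) refl refl, folded V_def]
  have carr: "loop_adj_matrix vs E S \<in> carrier_mat (length vs) (length vs)"
    by (simp add: loop_adj_matrix_def)
  \<comment> \<open>By symmetry the product is the square of a 0/1 entry, hence that entry;
    distinctness of \<open>vs\<close> matches equal indices with equal vertices.\<close>
  have entry: "loop_adj_matrix vs E S $$ (i, j) * loop_adj_matrix vs E S $$ (j, i) =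
      a (vs ! i) (vs ! j)" if "i < length vs" "j < length vs" for i j
    using that assms(1)
    by (auto simp: loop_adj_matrix_def a_def nth_eq_iff_index_eq insert_commute)
  have "sum_list (diag_mat (loop_adj_matrix vs E S * loop_adj_matrix vs E S)) =
      (\<Sum>i<length vs. \<Sum>j<length vs. a (vs ! i) (vs ! j))"
    unfolding sum_list_diag_mat_mult[OF carr carr] by (simp add: entry)
  also have "\<dots> = (\<Sum>i<length vs. \<Sum>v\<in>V. a (vs ! i) v)"
    by (intro sum.cong refl sum.reindex_bij_betw[OF bij])
  also have "\<dots> = (\<Sum>u\<in>V. \<Sum>v\<in>V. a u v)"
    by (rule sum.reindex_bij_betw[OF bij])
  also have "\<dots> = (\<Sum>(u, v)\<in>V \<times> V. a u v)"
    by (rule sum.cartesian_product)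
  \<comment> \<open>Restrict to the support of \<open>a\<close>: the ordered edges off the diagonal
    and the loops on it.\<close>
  also have "\<dots> = (\<Sum>(u, v)\<in>{(u, v). {u, v} \<in> E \<and> u \<noteq> v} \<union> (\<lambda>u. (u, u)) ` S. 1)"
    using V EV by (intro sum.mono_neutral_cong_right) (auto simp: a_def split: if_splits)
  also have "\<dots> = real (card ({(u, v). {u, v} \<in> E \<and> u \<noteq> v} \<union> (\<lambda>u. (u, u)) ` S))"
    by simp
  also have "card ({(u, v). {u, v} \<in> E \<and> u \<noteq> v} \<union> (\<lambda>u. (u, u)) ` S) =
      card {(u, v). {u, v} \<in> E \<and> u \<noteq> v} + card ((\<lambda>u. (u, u)) ` S)"
    using V EV finite_subset[of "{(u, v). {u, v} \<in> E \<and> u \<noteq> v}" "V \<times> V"]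
    by (intro card_Un_disjoint) (auto intro: finite_subset)
  also have "\<dots> = 2 * card E + card S"
    using card_ordered_edges[OF G] by (simp add: card_image inj_on_def)
  finally show ?thesis by simp
qed

text \<open>The sum of the squared deviations only grows when the mean is replaced by the midpoint of the interval.\<close>

lemma Popoviciu_inequality:
  fixes a :: "'i \<Rightarrow> real"
  assumes bounds: "\<And>i. i \<in> I \<Longrightarrow> l \<le> a i \<and> a i \<le> u"
  shows "real (card I) * (\<Sum>i\<in>I. (a i)\<^sup>2) - (\<Sum>i\<in>I. a i)\<^sup>2 \<le> (real (card I))\<^sup>2 / 4 * (u - l)\<^sup>2"
proof -
  define c where "c = (l + u) / 2"
  have "(a i - c)\<^sup>2 \<le> (u - l)\<^sup>2 / 4" if "i \<in> I" for i
  proof -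
    have "\<bar>a i - c\<bar> \<le> (u - l) / 2"
      using bounds[OF that] by (auto simp: c_def abs_le_iff field_simps)
    from power_mono[OF this, of 2] show ?thesis
      by (simp add: power_divide)
  qed
  then have le: "(\<Sum>i\<in>I. (a i - c)\<^sup>2) \<le> real (card I) * ((u - l)\<^sup>2 / 4)"
    by (rule sum_bounded_above)
  have eq: "(\<Sum>i\<in>I. (a i - c)\<^sup>2) =
      (\<Sum>i\<in>I. (a i)\<^sup>2) - 2 * c * (\<Sum>i\<in>I. a i) + real (card I) * c\<^sup>2"
    by (simp add: power2_diff sum.distrib sum_subtractf sum_distrib_left sum_distrib_right mult_ac)
  \<comment> \<open>This expression is unchanged when every \<open>a i\<close> is shifted by
    \<open>c\<close>; the square subtracted on the right is then dropped.\<close>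
  have "real (card I) * (\<Sum>i\<in>I. (a i)\<^sup>2) - (\<Sum>i\<in>I. a i)\<^sup>2 =
      real (card I) * (\<Sum>i\<in>I. (a i - c)\<^sup>2) - ((\<Sum>i\<in>I. a i) - real (card I) * c)\<^sup>2"
    unfolding eq by (simp add: power2_eq_square algebra_simps)
  also have "\<dots> \<le> real (card I) * (\<Sum>i\<in>I. (a i - c)\<^sup>2)"
    by simp
  also have "\<dots> \<le> real (card I) * (real (card I) * ((u - l)\<^sup>2 / 4))"
    by (intro mult_left_mono le) simp
  finally show ?thesis
    by (simp add: power2_eq_square mult_ac)
qed

theorem theorem10:
  fixes vs :: "'a list" and E :: "'a set set" and S :: "'a set"
    and n m \<sigma> :: nat and lam :: "nat \<Rightarrow> real"
  assumes "distinct vs" and "length vs = n" and "n \<ge> 1"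
    and "simple_graph (set vs) E" and "card E = m"
    and "S \<subseteq> set vs" and "card S = \<sigma>"
    and "image_mset lam (mset_set {1..n}) = loop_adj_eigenvalues vs E S"
    and "\<And>i j. 1 \<le> i \<Longrightarrow> i \<le> j \<Longrightarrow> j \<le> n \<Longrightarrow>
      \<bar>lam i - real \<sigma> / real n\<bar> \<ge> \<bar>lam j - real \<sigma> / real n\<bar>"
  shows "loop_energy vs E S \<ge>
    sqrt (real n * (2 * real m + real \<sigma> - (real \<sigma>)\<^sup>2 / real n)
      - (real n)\<^sup>2 / 3 *
        (\<bar>lam 1 - real \<sigma> / real n\<bar> - \<bar>lam n - real \<sigma> / real n\<bar>)\<^sup>2)"
proof -
  define c where "c = real \<sigma> / real n"
  define a where "a i = \<bar>lam i - c\<bar>" for i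
  have roots: "proots (char_poly (loop_adj_matrix vs E S)) = image_mset lam (mset_set {1..n})"
    using assms(8) by (simp add: loop_adj_eigenvalues_def)
  have carr: "loop_adj_matrix vs E S \<in> carrier_mat n n"
    using assms(2) by (simp add: loop_adj_matrix_def)
  \<comment> \<open>The enumeration \<open>lam\<close> provides \<open>n\<close> real roots, so the
    characteristic polynomial splits over the reals.\<close>
  have size: "size (proots (char_poly (loop_adj_matrix vs E S))) = n"
    by (simp add: roots)
  note moments = sum_mset_proots_char_poly[OF carr size, unfolded roots]
  have sum1: "(\<Sum>i\<in>{1..n}. lam i) = real \<sigma>"
    using moments(1) trace_loop_adj_matrix[OF assms(1,6)] assms(7)
    by (simp add: sum_unfold_sum_mset)
  have sum2: "(\<Sum>i\<in>{1..n}. (lam i)\<^sup>2) = 2 * real m + real \<sigma>"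
    using moments(2) trace_loop_adj_matrix_square[OF assms(1,6,4)] assms(5,7)
    by (simp add: sum_unfold_sum_mset image_mset.compositionality comp_def)
  have "(\<Sum>i\<in>{1..n}. (a i)\<^sup>2) =
      (\<Sum>i\<in>{1..n}. (lam i)\<^sup>2) - 2 * c * (\<Sum>i\<in>{1..n}. lam i) + real n * c\<^sup>2"
    by (simp add: a_def power2_diff sum.distrib sum_subtractf sum_distrib_left mult_ac)
  \<comment> \<open>Since \<open>c\<close> is the mean of the eigenvalues, the last two terms
    combine to \<open>- n * c^2\<close>.\<close>
  also have "\<dots> = 2 * real m + real \<sigma> - (real \<sigma>)\<^sup>2 / real n"
    using assms(3) unfolding sum1 sum2 by (simp add: c_def field_simps power2_eq_square)
  finally have sq: "(\<Sum>i\<in>{1..n}. (a i)\<^sup>2) = 2 * real m + real \<sigma> - (real \<sigma>)\<^sup>2 / real n" .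
  have energy: "loop_energy vs E S = (\<Sum>i\<in>{1..n}. a i)"
    unfolding loop_energy_def assms(8)[symmetric]
    by (simp add: sum_unfold_sum_mset image_mset.compositionality comp_def a_def c_def assms(2,7))
  \<comment> \<open>The decreasing order makes \<open>a n\<close> and \<open>a 1\<close> the extreme
    values.\<close>
  have "real n * (\<Sum>i\<in>{1..n}. (a i)\<^sup>2) - (\<Sum>i\<in>{1..n}. a i)\<^sup>2 \<le> (real n)\<^sup>2 / 4 * (a 1 - a n)\<^sup>2"
    using Popoviciu_inequality[of "{1..n}" "a n" a "a 1"] assms(9) by (simp add: a_def c_def)
  also have "\<dots> \<le> (real n)\<^sup>2 / 3 * (a 1 - a n)\<^sup>2"
    by (intro mult_right_mono) auto
  finally have "real n * (\<Sum>i\<in>{1..n}. (a i)\<^sup>2) - (real n)\<^sup>2 / 3 * (a 1 - a n)\<^sup>2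
      \<le> (\<Sum>i\<in>{1..n}. a i)\<^sup>2"
    by simp
  \<comment> \<open>The radicand can be negative; \<open>sqrt\<close> is then negative too, and the
    bound holds because the energy is nonnegative.\<close>
  moreover have "0 \<le> (\<Sum>i\<in>{1..n}. a i)"
    by (simp add: a_def sum_nonneg)
  ultimately show ?thesis
    unfolding energy sq by (intro real_le_lsqrt) (simp_all add: a_def c_def)
qed

end
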